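(* Let $f:\mathbb{N}\to\mathbb{C}$ with $f(1)\neq 0$. Then $$f^{-1\circ}=\xi\left(\frac{f}{\xi}\right)^{-1*}\qquad\text{and}\qquad f^{-1*}=\frac{(\xi f)^{-1\circ}}{\xi}.$$
   Context: For $n\in\mathbb{N}$ write $n=\prod_p p^{\nu_p(n)}$. The Dirichlet convolution is $(f*g)(n)=\sum_{d\mid n}f(d)g(n/d)$ and the binomial convolution is $(f\circ g)(n)=\sum_{d\mid n}\left(\prod_p\binom{\nu_p(n)}{\nu_p(d)}\right)f(d)g(n/d)$. Both have identity $\delta$, where $\delta(1)=1$ and $\delta(n)=0$ for $n>1$. For $f$ with $f(1)\ne0$, $f^{-1\circ}$ and $f^{-1*}$ denote the inverses of $f$ under $\circ$ and under $*$ respectively (these exist exactly when $f(1)\ne 0$). $\xi(n)=\prod_p\nu_p(n)!$. Products and quotients of functions are pointwise. *)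

theory Defs
  imports Complex_Main "HOL-Computational_Algebra.Primes"
begin

text \<open>
  Arithmetic functions live on the positive integers and are represented by functions on type
  \<^typ>\<open>nat\<close>. The value at 0 is immaterial: as 0 has infinitely many divisors, the divisor
  sums below are 0 there, so they never see the value of an argument at 0.
\<close>

definition dirichlet_conv :: "(nat \<Rightarrow> complex) \<Rightarrow> (nat \<Rightarrow> complex) \<Rightarrow> nat \<Rightarrow> complex" where
  "dirichlet_conv f g n = (\<Sum>d | d dvd n. f d * g (n div d))"

text \<open>
  The products over all primes are restricted to the prime factors of \<open>n\<close>; every other prime
  contributes the factor 1.
\<close>

definition binomial_conv :: "(nat \<Rightarrow> complex) \<Rightarrow> (nat \<Rightarrow> complex) \<Rightarrow> nat \<Rightarrow> complex" where
  "binomial_conv f g n =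
     (\<Sum>d | d dvd n.
        of_nat (\<Prod>p\<in>prime_factors n. multiplicity p n choose multiplicity p d) * f d * g (n div d))"

definition xi :: "nat \<Rightarrow> complex" where
  "xi n = of_nat (\<Prod>p\<in>prime_factors n. fact (multiplicity p n))"

definition conv_one :: "nat \<Rightarrow> complex" where
  "conv_one n = (if n = 1 then 1 else 0)"

text \<open>
  The inverse with respect to a convolution. The clause \<open>g 0 = 0\<close> only fixes the immaterial value
  at 0, which makes the inverse unique as a function on type \<^typ>\<open>nat\<close>.
\<close>

definition is_conv_inverse ::
  "((nat \<Rightarrow> complex) \<Rightarrow> (nat \<Rightarrow> complex) \<Rightarrow> nat \<Rightarrow> complex) \<Rightarrow>
   (nat \<Rightarrow> complex) \<Rightarrow> (nat \<Rightarrow> complex) \<Rightarrow> bool" where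
  "is_conv_inverse conv f g \<longleftrightarrow> g 0 = 0 \<and> conv f g = conv_one \<and> conv g f = conv_one"

definition conv_inverse ::
  "((nat \<Rightarrow> complex) \<Rightarrow> (nat \<Rightarrow> complex) \<Rightarrow> nat \<Rightarrow> complex) \<Rightarrow>
   (nat \<Rightarrow> complex) \<Rightarrow> nat \<Rightarrow> complex" where
  "conv_inverse conv f = (THE g. is_conv_inverse conv f g)"

abbreviation dirichlet_inverse :: "(nat \<Rightarrow> complex) \<Rightarrow> nat \<Rightarrow> complex" where
  "dirichlet_inverse \<equiv> conv_inverse dirichlet_conv"

abbreviation binomial_inverse :: "(nat \<Rightarrow> complex) \<Rightarrow> nat \<Rightarrow> complex" where
  "binomial_inverse \<equiv> conv_inverse binomial_conv"

text \<open>
  Both inverses exist, and are unique, exactly when \<open>f 1 \<noteq> 0\<close>, so that the definite description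
  above is meaningful. Both convolutions are instances of a weighted divisor sum.
\<close>

definition weighted_conv ::
  "(nat \<Rightarrow> nat \<Rightarrow> complex) \<Rightarrow> (nat \<Rightarrow> complex) \<Rightarrow> (nat \<Rightarrow> complex) \<Rightarrow> nat \<Rightarrow> complex" where
  "weighted_conv w f g n = (\<Sum>d | d dvd n. w n d * f d * g (n div d))"

lemma dirichlet_conv_eq_weighted: "dirichlet_conv = weighted_conv (\<lambda>_ _. 1)"
  by (intro ext) (simp add: dirichlet_conv_def weighted_conv_def)

lemma binomial_conv_eq_weighted:
  "binomial_conv = weighted_conv
     (\<lambda>n d. of_nat (\<Prod>p\<in>prime_factors n. multiplicity p n choose multiplicity p d))"
  by (intro ext) (simp add: binomial_conv_def weighted_conv_def)

context
  fixes w :: "nat \<Rightarrow> nat \<Rightarrow> complex"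
  assumes w_one: "\<And>n. n > 0 \<Longrightarrow> w n 1 = 1"
    and w_sym: "\<And>n d. n > 0 \<Longrightarrow> d dvd n \<Longrightarrow> w n (n div d) = w n d"
begin

private lemma weighted_conv_zero: "weighted_conv w f g 0 = 0"
  by (simp add: weighted_conv_def)

private lemma weighted_conv_commute: "weighted_conv w f g = weighted_conv w g f"
proof
  fix n :: nat
  show "weighted_conv w f g n = weighted_conv w g f n"
  proof (cases "n = 0")
    case False
    show ?thesis unfolding weighted_conv_def
      by (rule sum.reindex_bij_witness[of _ "\<lambda>d. n div d" "\<lambda>d. n div d"])
         (use False w_sym in \<open>auto simp: div_div_eq_right mult_ac elim!: dvdE\<close>)
  qed (simp add: weighted_conv_zero)
qed

private lemma weighted_conv_rec:
  assumes "n > 0"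
  shows "weighted_conv w f g n =
           f 1 * g n + (\<Sum>d | d dvd n \<and> d \<noteq> 1. w n d * f d * g (n div d))"
proof -
  have "{d. d dvd n} = insert 1 {d. d dvd n \<and> d \<noteq> 1}" by auto
  moreover have "finite {d. d dvd n \<and> d \<noteq> 1}"
    using assms by (auto intro: finite_subset[OF _ finite_divisors_nat[of n]])
  ultimately show ?thesis
    using assms w_one[of n] by (simp add: weighted_conv_def)
qed

private function weighted_inv :: "(nat \<Rightarrow> complex) \<Rightarrow> nat \<Rightarrow> complex" where
  "weighted_inv f n = (if n = 0 then 0 else
     (conv_one n - (\<Sum>d | n > 0 \<and> d dvd n \<and> d \<noteq> 1. w n d * f d * weighted_inv f (n div d))) / f 1)"
  by auto
termination
proof (relation "measure snd")
  fix f :: "nat \<Rightarrow> complex" and n d :: nat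
  assume "n \<noteq> 0" "d \<in> {d. n > 0 \<and> d dvd n \<and> d \<noteq> 1}"
  moreover from this have "d \<noteq> 0" by auto
  ultimately show "((f, n div d), f, n) \<in> measure snd"
    by (auto intro!: div_less_dividend)
qed simp

private lemma weighted_inverse_unique:
  assumes "f 1 \<noteq> 0" "weighted_conv w f g = weighted_conv w f h" "g 0 = h 0"
  shows "g n = h n"
proof (induction n rule: less_induct)
  case (less n)
  show ?case
  proof (cases "n = 0")
    case False
    have "g (n div d) = h (n div d)" if "d dvd n" "d \<noteq> 1" for d
    proof (rule less.IH)
      have "d \<noteq> 0" using that False by auto
      then show "n div d < n" using that False by (intro div_less_dividend) auto
    qed
    then have "(\<Sum>d | d dvd n \<and> d \<noteq> 1. w n d * f d * g (n div d)) =
               (\<Sum>d | d dvd n \<and> d \<noteq> 1. w n d * f d * h (n div d))"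
      by (intro sum.cong) auto
    moreover have "weighted_conv w f g n = weighted_conv w f h n"
      using assms by simp
    ultimately show ?thesis
      using assms(1) False by (simp add: weighted_conv_rec)
  qed (use assms in simp)
qed

lemma ex1_weighted_inverse:
  "(\<exists>!g. is_conv_inverse (weighted_conv w) f g) \<longleftrightarrow> f 1 \<noteq> 0"
  "(\<exists>g. is_conv_inverse (weighted_conv w) f g) \<longleftrightarrow> f 1 \<noteq> 0"
proof -
  have nonzero: "f 1 \<noteq> 0" if "is_conv_inverse (weighted_conv w) f g" for g
  proof
    assume "f 1 = 0"
    then have "weighted_conv w f g 1 = 0" by (simp add: weighted_conv_def)
    with that show False by (simp add: is_conv_inverse_def conv_one_def)
  qed
  have ex: "is_conv_inverse (weighted_conv w) f (weighted_inv f)" if "f 1 \<noteq> 0"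
  proof -
    have "weighted_conv w f (weighted_inv f) n = conv_one n" for n
    proof (cases "n = 0")
      case True
      then show ?thesis by (simp add: weighted_conv_zero conv_one_def)
    next
      case False
      have "f 1 * weighted_inv f n = conv_one n -
              (\<Sum>d | d dvd n \<and> d \<noteq> 1. w n d * f d * weighted_inv f (n div d))"
        using False that by (subst weighted_inv.simps) (simp del: weighted_inv.simps)
      then show ?thesis
        using False by (simp add: weighted_conv_rec del: weighted_inv.simps)
    qed
    then have "weighted_conv w f (weighted_inv f) = conv_one" by blast
    then show ?thesis
      using weighted_conv_commute[of f "weighted_inv f"] by (simp add: is_conv_inverse_def)
  qed
  have unique: "g = h" if "is_conv_inverse (weighted_conv w) f g"
    "is_conv_inverse (weighted_conv w) f h" for g h
    using weighted_inverse_unique[of f g h] nonzero[OF that(1)] that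
    by (auto simp: is_conv_inverse_def)
  show "(\<exists>g. is_conv_inverse (weighted_conv w) f g) \<longleftrightarrow> f 1 \<noteq> 0"
    using nonzero ex by blast
  show "(\<exists>!g. is_conv_inverse (weighted_conv w) f g) \<longleftrightarrow> f 1 \<noteq> 0"
    using nonzero ex unique by blast
qed

end

lemma ex1_dirichlet_inverse:
  "(\<exists>!g. is_conv_inverse dirichlet_conv f g) \<longleftrightarrow> f 1 \<noteq> 0"
  "(\<exists>g. is_conv_inverse dirichlet_conv f g) \<longleftrightarrow> f 1 \<noteq> 0"
  unfolding dirichlet_conv_eq_weighted by (rule ex1_weighted_inverse; simp)+

lemma binomial_weight_sym:
  fixes n d :: nat
  assumes "n > 0" "d dvd n"
  shows "(\<Prod>p\<in>prime_factors n. multiplicity p n choose multiplicity p (n div d)) =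
         (\<Prod>p\<in>prime_factors n. multiplicity p n choose multiplicity p d)"
proof (rule prod.cong)
  fix p assume "p \<in> prime_factors n"
  then have p: "prime p" by auto
  obtain k where k: "n = d * k" using assms by auto
  with assms have "d \<noteq> 0" "k \<noteq> 0" by auto
  then have "multiplicity p n = multiplicity p d + multiplicity p k"
    using p k by (simp add: prime_elem_multiplicity_mult_distrib)
  moreover have "n div d = k" using k \<open>d \<noteq> 0\<close> by simp
  ultimately show "multiplicity p n choose multiplicity p (n div d) =
                   multiplicity p n choose multiplicity p d"
    using binomial_symmetric[of "multiplicity p d" "multiplicity p n"] by simp
qed simp

lemma ex1_binomial_inverse:
  "(\<exists>!g. is_conv_inverse binomial_conv f g) \<longleftrightarrow> f 1 \<noteq> 0"
  "(\<exists>g. is_conv_inverse binomial_conv f g) \<longleftrightarrow> f 1 \<noteq> 0"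
proof -
  let ?w = "\<lambda>(n::nat) (d::nat). complex_of_nat
              (\<Prod>p\<in>prime_factors n. multiplicity p n choose multiplicity p d)"
  have one: "?w n 1 = 1" for n by simp
  have sym: "?w n (n div d) = ?w n d" if "n > 0" "d dvd n" for n d
    using binomial_weight_sym[OF that] by simp
  show "(\<exists>!g. is_conv_inverse binomial_conv f g) \<longleftrightarrow> f 1 \<noteq> 0"
    unfolding binomial_conv_eq_weighted by (rule ex1_weighted_inverse(1)[OF one sym])
  show "(\<exists>g. is_conv_inverse binomial_conv f g) \<longleftrightarrow> f 1 \<noteq> 0"
    unfolding binomial_conv_eq_weighted by (rule ex1_weighted_inverse(2)[OF one sym])
qed

end

theory Submission
  imports Defs
begin

text \<open>
  Since \<open>\<xi>(n) = (\<Prod>p. \<nu>\<^sub>p(n) choose \<nu>\<^sub>p(d)) \<xi>(d) \<xi>(n/d)\<close> for \<open>d\<close> dividing \<open>n\<close>, multiplication by \<open>\<xi>\<close>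
  is an isomorphism from the Dirichlet convolution algebra onto the binomial one. As \<open>\<xi>(1) = 1\<close>, it
  fixes the identity, so it carries inverses to inverses.
\<close>

lemma xi_nonzero: "xi n \<noteq> 0"
  by (simp add: xi_def)

text \<open>A prime of \<open>A\<close> outside \<open>prime_factors n\<close> has multiplicity 0
  and contributes 0! = 1. This allows \<open>xi\<close> of several numbers to be written over one
  common set of primes.\<close>

lemma xi_eq_prod_superset:
  assumes "finite A" "prime_factors n \<subseteq> A" "\<And>p. p \<in> A \<Longrightarrow> prime p" "n \<noteq> 0"
  shows "xi n = of_nat (\<Prod>p\<in>A. fact (multiplicity p n))"
proof -
  have "fact (multiplicity p n) = (1::nat)" if "p \<in> A - prime_factors n" for p
    using that assms by (auto simp: prime_factors_multiplicity)
  then have "(\<Prod>p\<in>prime_factors n. fact (multiplicity p n)) =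
             (\<Prod>p\<in>A. fact (multiplicity p n) :: nat)"
    using assms by (intro prod.mono_neutral_left) auto
  then show ?thesis by (simp only: xi_def)
qed

text \<open>Prime by prime this is (a + b)! = (a + b choose a) a! b!, where a and b are the
  multiplicities in \<open>d\<close> and \<open>k\<close>.\<close>

lemma xi_mult:
  assumes "d > 0" "k > 0"
  shows "xi (d * k) =
    of_nat (\<Prod>p\<in>prime_factors (d * k). multiplicity p (d * k) choose multiplicity p d) * xi d * xi k"
proof -
  let ?P = "prime_factors (d * k)"
  have P: "prime_factors d \<subseteq> ?P" "prime_factors k \<subseteq> ?P"
    using assms by (intro dvd_prime_factors; simp)+
  have "fact (multiplicity p (d * k)) =
          (multiplicity p (d * k) choose multiplicity p d) *
          fact (multiplicity p d) * (fact (multiplicity p k) :: nat)" if "p \<in> ?P" for p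
  proof -
    have "multiplicity p (d * k) = multiplicity p d + multiplicity p k"
      using that assms by (auto intro!: prime_elem_multiplicity_mult_distrib)
    then show ?thesis
      using binomial_fact_lemma[of "multiplicity p d" "multiplicity p (d * k)"]
      by (simp add: mult_ac)
  qed
  then have "(\<Prod>p\<in>?P. fact (multiplicity p (d * k))) =
      (\<Prod>p\<in>?P. multiplicity p (d * k) choose multiplicity p d) *
      (\<Prod>p\<in>?P. fact (multiplicity p d)) * (\<Prod>p\<in>?P. fact (multiplicity p k) :: nat)"
    by (simp add: prod.distrib)
  moreover have "xi d = of_nat (\<Prod>p\<in>?P. fact (multiplicity p d))"
    "xi k = of_nat (\<Prod>p\<in>?P. fact (multiplicity p k))"
    using P assms by (intro xi_eq_prod_superset; force)+
  ultimately show ?thesis by (simp only: xi_def[of "d * k"] of_nat_mult)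
qed

lemma binomial_conv_xi_mult:
  "binomial_conv (\<lambda>m. xi m * f m) (\<lambda>m. xi m * g m) n = xi n * dirichlet_conv f g n"
proof (cases "n = 0")
  \<comment> \<open>Both divisor sums range over an infinite set here, so both are 0.\<close>
  case True
  then show ?thesis by (simp add: binomial_conv_def dirichlet_conv_def)
next
  case False
  show ?thesis
    unfolding binomial_conv_def dirichlet_conv_def sum_distrib_left
  \<comment> \<open>The sums agree term by term: \<open>xi_mult\<close> applied to n = d * k absorbs
    the binomial weight into \<open>xi n\<close>.\<close>
  proof (rule sum.cong)
    fix d assume "d \<in> {d. d dvd n}"
    then obtain k where n: "n = d * k" by auto
    with False have "d > 0" "k > 0" by auto
    then show "of_nat (\<Prod>p\<in>prime_factors n. multiplicity p n choose multiplicity p d) *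
        (xi d * f d) * (xi (n div d) * g (n div d)) = xi n * (f d * g (n div d))"
      using xi_mult[of d k] by (simp add: n mult_ac del: of_nat_prod)
  qed simp
qed

lemma is_conv_inverse_xi_mult:
  assumes "is_conv_inverse dirichlet_conv f g"
  shows "is_conv_inverse binomial_conv (\<lambda>m. xi m * f m) (\<lambda>m. xi m * g m)"
proof -
  \<comment> \<open>At 1 the product defining \<open>xi\<close> is empty; everywhere else, including
    0, \<open>conv_one\<close> vanishes.\<close>
  have "xi n * conv_one n = conv_one n" for n
    by (simp add: conv_one_def xi_def)
  with assms show ?thesis
    by (auto simp: is_conv_inverse_def binomial_conv_xi_mult fun_eq_iff)
qed

lemma binomial_inverse_xi_mult:
  assumes "f 1 \<noteq> 0"
  shows "binomial_inverse (\<lambda>m. xi m * f m) = (\<lambda>n. xi n * dirichlet_inverse f n)"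
proof -
  have "\<exists>!g. is_conv_inverse dirichlet_conv f g"
    using assms ex1_dirichlet_inverse(1)[of f] by blast
  then have "is_conv_inverse dirichlet_conv f (dirichlet_inverse f)"
    unfolding conv_inverse_def by (rule theI')
  then have "is_conv_inverse binomial_conv (\<lambda>m. xi m * f m) (\<lambda>n. xi n * dirichlet_inverse f n)"
    by (rule is_conv_inverse_xi_mult)
  \<comment> \<open>The function just found is an inverse; uniqueness identifies it with the one
    that the definite description selects.\<close>
  moreover have "\<exists>!g. is_conv_inverse binomial_conv (\<lambda>m. xi m * f m) g"
    using assms xi_nonzero[of 1] ex1_binomial_inverse(1)[of "\<lambda>m. xi m * f m"] by simp
  ultimately show ?thesis
    unfolding conv_inverse_def[of binomial_conv] by (rule the1_equality[rotated])
qed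

theorem theorem2p2:
  fixes f :: "nat \<Rightarrow> complex"
  assumes "f 1 \<noteq> 0"
  shows "binomial_inverse f = (\<lambda>n. xi n * dirichlet_inverse (\<lambda>m. f m / xi m) n) \<and>
         dirichlet_inverse f = (\<lambda>n. binomial_inverse (\<lambda>m. xi m * f m) n / xi n)"
proof
  show "binomial_inverse f = (\<lambda>n. xi n * dirichlet_inverse (\<lambda>m. f m / xi m) n)"
    \<comment> \<open>As \<open>xi\<close> never vanishes, \<open>f\<close> is \<open>xi\<close>
      times \<open>f / xi\<close>.\<close>
    using binomial_inverse_xi_mult[of "\<lambda>m. f m / xi m"] assms by (simp add: xi_nonzero)
  show "dirichlet_inverse f = (\<lambda>n. binomial_inverse (\<lambda>m. xi m * f m) n / xi n)"
    \<comment> \<open>Here the transfer is applied to \<open>f\<close> itself and the factor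
      \<open>xi n\<close> is cancelled.\<close>
    using binomial_inverse_xi_mult[of f] assms by (simp add: xi_nonzero)
qed

end
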